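(* Let $x=(x_1,\dots,x_N)$ be the feature vector of some element of the training set $\mathcal D_{tr}$. Suppose that the parameters $\theta_\triangle,\theta_\phi$ result from optimizing $L_v(x_{\mathcal S},O_{\mathcal S})$ and $L_s^{(i)}(x_{\mathcal S})$ for all subsets of $x$ and all permutations, i.e. for every nonempty $\mathcal S\subseteq\mathcal N$: (1) for every $O_{\mathcal S}\in\pi(\mathcal S)$, $\dfrac{\partial L_v(x_{\mathcal S},O_{\mathcal S})}{\partial\theta_\triangle}=0$ and $\dfrac{\partial f_c(x_{\mathcal S},O_{\mathcal S};\theta_\triangle)}{\partial\theta_\triangle}\neq 0$; (2) for every $i\in\mathcal S$, with $L_s^{(i)}(x_{\mathcal S})$ formed with all permutations of $\mathcal S$, $\dfrac{\partial L_s^{(i)}(x_{\mathcal S})}{\partial\theta_\phi}=0$ and $\dfrac{\partial \phi(x_{\mathcal S};\theta_\phi)_i}{\partial\theta_\phi}\neq 0$. Then $\phi(x;\theta_\phi)=\phi(x_{\mathcal N};\theta_\phi)$ is the Shapley value of $f$, i.e. for every $i\in\mathcal N$, $$\phi(x;\theta_\phi)_i=\frac1{N!}\sum_{O\in\pi(\mathcal N)}\sum_{k=1}^N \mathbb I\{O_k=i\}\,\bigl(f(x_{O_{1:k}};\theta_\phi)-f(x_{O_{1:k-1}};\theta_\phi)\bigr).$$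
   Context: Let $N\ge1$, $\mathcal N=\{1,\dots,N\}$. For $\mathcal S\subseteq\mathcal N$ write $x_{\mathcal S}=\{x_i: i\in\mathcal S\}$ for the sub-collection of features indexed by $\mathcal S$ (so $x=x_{\mathcal N}$), and $\pi(\mathcal S)$ for the set of all $|\mathcal S|!$ orderings $O=(O_1,\dots,O_{|\mathcal S|})$ of $\mathcal S$; $O_{1:k}$ denotes the first $k$ entries of $O$ ($O_{1:0}$ is empty). $\mathbb I$ is the indicator and $\sigma(t)=1/(1+e^{-t})$. Marginal contribution module: real numbers $\triangle(x_{j_k},x_{(j_1,\dots,j_{k-1})};\theta_\triangle)$, defined for every finite sequence $(j_1,\dots,j_k)$ of distinct indices (they may depend on the order of the prefix), differentiable in $\theta_\triangle\in\mathbb R^q$. With a fixed constant $\phi_0\in\mathbb R$, the permutation-variant output is $$f_c(x_{\mathcal S},O;\theta_\triangle)=\phi_0+\sum_{k=1}^{|\mathcal S|}\triangle(x_{O_k},x_{O_{1:k-1}};\theta_\triangle),\qquad O\in\pi(\mathcal S).$$ Attribution network: for nonempty $\mathcal S\subseteq\mathcal N$ and $i\in\mathcal S$, a real number $\phi(x_{\mathcal S};\theta_\phi)_i$ differentiable in $\theta_\phi\in\mathbb R^p$. The final output is $f(x_{\mathcal S};\theta_\phi)=\phi_0+\sum_{i\in\mathcal S}\phi(x_{\mathcal S};\theta_\phi)_i$, with $f(x_\emptyset;\theta_\phi)=\phi_0$. Losses: $\mathcal D_{tr}$ is a finite collection of pairs $(x',y')$ with $x'\in\mathbb R^N$, $y'\in\{0,1\}$.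 Put $L_m(x_{\mathcal S},y,O)=-y\log\sigma(f_c(x_{\mathcal S},O;\theta_\triangle))-(1-y)\log(1-\sigma(f_c(x_{\mathcal S},O;\theta_\triangle)))$, $$L_v(x_{\mathcal S},O)=\frac{\sum_{(x',y')\in\mathcal D_{tr}}\mathbb I\{x'_{\mathcal S}=x_{\mathcal S}\}L_m(x_{\mathcal S},y',O)}{\sum_{(x',y')\in\mathcal D_{tr}}\mathbb I\{x'_{\mathcal S}=x_{\mathcal S}\}},$$ and, with the full set of permutations, $$L_s^{(i)}(x_{\mathcal S})=\frac1{|\mathcal S|!}\sum_{O\in\pi(\mathcal S)}\Bigl(\phi(x_{\mathcal S};\theta_\phi)_i-\sum_{k=1}^{|\mathcal S|}\mathbb I\{O_k=i\}\triangle(x_i,x_{O_{1:k-1}};\theta_\triangle)\Bigr)^2.$$ The derivative of $L_v$ is taken with respect to $\theta_\triangle$, and the derivative of $L_s^{(i)}$ with respect to $\theta_\phi$, with $\theta_\triangle$ fixed. Convention: "optimizing a loss makes the model converge to" a property means that the property holds at parameters where the gradient of the loss vanishes while the gradient of the corresponding network output does not (no gradient vanishing). *)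

theory Defs
  imports "HOL-Analysis.Analysis" "HOL-Combinatorics.Multiset_Permutations"
begin

text \<open>
  The feature indices are the elements of a finite type \<open>'n\<close>, so that \<open>N = CARD('n) \<ge> 1\<close>,
  the index set is \<open>UNIV\<close>, and feature vectors have type \<open>real ^ 'n\<close>.
  The orderings of \<open>S\<close> are the lists in \<^term>\<open>permutations_of_set S\<close>; lists are indexed
  from 0, so \<open>O\<^sub>k\<close> is \<open>os ! (k - 1)\<close>, while \<open>take k os\<close> consists of the first \<open>k\<close> entries.
\<close>

text \<open>
  The sub-collection \<open>x\<^sub>S\<close> is a partial map with domain \<open>S\<close>, so it carries its index set.
\<close>

definition subfeatures :: "real ^ 'n \<Rightarrow> 'n set \<Rightarrow> ('n \<rightharpoonup> real)" where
  "subfeatures x S = (\<lambda>i. Some (x $ i)) |` S"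

text \<open>
  The marginal contribution module may depend on indices, on feature values and on the order
  of the prefix: a single feature is passed to it as an index-value pair, a prefix as the list
  of such pairs.
\<close>

type_synonym ('n, 'q) marginal_module =
  "'n \<times> real \<Rightarrow> ('n \<times> real) list \<Rightarrow> real ^ 'q \<Rightarrow> real"

type_synonym ('n, 'p) attribution_network =
  "('n \<rightharpoonup> real) \<Rightarrow> real ^ 'p \<Rightarrow> 'n \<Rightarrow> real"

definition marginal ::
    "('n, 'q) marginal_module \<Rightarrow> real ^ 'n \<Rightarrow> 'n \<Rightarrow> 'n list \<Rightarrow> real ^ 'q \<Rightarrow> real" where
  "marginal \<Delta> x j js \<theta> = \<Delta> (j, x $ j) (map (\<lambda>l. (l, x $ l)) js) \<theta>"

definition variant_output ::
    "real \<Rightarrow> ('n, 'q) marginal_module \<Rightarrow> real ^ 'n \<Rightarrow> 'n set \<Rightarrow> 'n list \<Rightarrow> real ^ 'q \<Rightarrow> real" where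
  "variant_output \<phi>\<^sub>0 \<Delta> x S os \<theta> =
     \<phi>\<^sub>0 + (\<Sum>k = 1..card S. marginal \<Delta> x (os ! (k - 1)) (take (k - 1) os) \<theta>)"

definition final_output ::
    "real \<Rightarrow> ('n, 'p) attribution_network \<Rightarrow> real ^ 'n \<Rightarrow> 'n set \<Rightarrow> real ^ 'p \<Rightarrow> real" where
  "final_output \<phi>\<^sub>0 \<phi> x S \<theta> = \<phi>\<^sub>0 + (\<Sum>i\<in>S. \<phi> (subfeatures x S) \<theta> i)"

definition sigmoid :: "real \<Rightarrow> real" where
  "sigmoid t = 1 / (1 + exp (- t))"

definition loss_m ::
    "real \<Rightarrow> ('n, 'q) marginal_module \<Rightarrow> real ^ 'n \<Rightarrow> 'n set \<Rightarrow> real \<Rightarrow> 'n list \<Rightarrow> real ^ 'q \<Rightarrow> real"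
  where
  "loss_m \<phi>\<^sub>0 \<Delta> x S y os \<theta> =
     - y * ln (sigmoid (variant_output \<phi>\<^sub>0 \<Delta> x S os \<theta>))
     - (1 - y) * ln (1 - sigmoid (variant_output \<phi>\<^sub>0 \<Delta> x S os \<theta>))"

definition loss_v ::
    "((real ^ 'n) \<times> real) multiset \<Rightarrow> real \<Rightarrow> ('n, 'q) marginal_module \<Rightarrow>
     real ^ 'n \<Rightarrow> 'n set \<Rightarrow> 'n list \<Rightarrow> real ^ 'q \<Rightarrow> real" where
  "loss_v D \<phi>\<^sub>0 \<Delta> x S os \<theta> =
     (\<Sum>(x', y') \<in># D. of_bool (subfeatures x' S = subfeatures x S) * loss_m \<phi>\<^sub>0 \<Delta> x S y' os \<theta>) /
     (\<Sum>(x', y') \<in># D. of_bool (subfeatures x' S = subfeatures x S))"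

definition loss_s ::
    "('n, 'q) marginal_module \<Rightarrow> real ^ 'q \<Rightarrow> ('n, 'p) attribution_network \<Rightarrow>
     real ^ 'n \<Rightarrow> 'n set \<Rightarrow> 'n \<Rightarrow> real ^ 'p \<Rightarrow> real" where
  "loss_s \<Delta> \<theta>\<^sub>\<Delta> \<phi> x S i \<theta> =
     1 / fact (card S) *
     (\<Sum>os \<in> permutations_of_set S.
        (\<phi> (subfeatures x S) \<theta> i -
         (\<Sum>k = 1..card S. of_bool (os ! (k - 1) = i) *
            marginal \<Delta> x i (take (k - 1) os) \<theta>\<^sub>\<Delta>))\<^sup>2)"

definition shapley_value :: "('n::finite set \<Rightarrow> real) \<Rightarrow> 'n \<Rightarrow> real" where
  "shapley_value v i =
     1 / fact CARD('n) *
     (\<Sum>os \<in> permutations_of_set UNIV. \<Sum>k = 1..CARD('n).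
        of_bool (os ! (k - 1) = i) * (v (set (take k os)) - v (set (take (k - 1) os))))"

end

theory Submission
  imports Defs
begin

text \<open>
  Both optimality conditions are chain rules: a vanishing gradient of \<open>h \<circ> f\<close>, where the
  gradient of \<open>f\<close> does not vanish, forces the derivative of \<open>h\<close> to vanish. For the cross entropy
  this says that the sigmoid of \<open>f\<^sub>c(x\<^sub>S, O)\<close> is the mean label of the training points that agree
  with \<open>x\<close> on \<open>S\<close>, so \<open>f\<^sub>c(x\<^sub>S, O)\<close> does not depend on \<open>O\<close>. For the quadratic loss it says that
  \<open>\<phi>(x\<^sub>S)\<^sub>i\<close> is the mean over \<open>O\<close> of the marginal contribution of \<open>i\<close>. Summing over \<open>i\<close>
  identifies \<open>f(x\<^sub>S)\<close> with the common value of \<open>f\<^sub>c(x\<^sub>S, O)\<close>; since marginal contributions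
  are differences of consecutive values of \<open>f\<^sub>c\<close>, they are differences of values of \<open>f\<close>.
\<close>

lemma GDERIV_compose_zeroD:
  assumes f: "GDERIV f x :> g" "g \<noteq> 0"
    and h: "DERIV h (f x) :> d"
    and hf: "GDERIV (\<lambda>x. h (f x)) x :> 0"
  shows "d = 0"
proof -
  have "GDERIV (\<lambda>x. h (f x)) x :> d *\<^sub>R g"
    by (rule GDERIV_DERIV_compose[OF f(1) h])
  then have "(\<lambda>v. v \<bullet> (d *\<^sub>R g)) = (\<lambda>v. v \<bullet> 0)"
    using hf unfolding gderiv_def by (rule has_derivative_unique)
  \<comment> \<open>Two gradients of one function agree as functionals; evaluating both at
    \<open>d *\<^sub>R g\<close> itself gives a vanishing norm.\<close>
  then have "(d *\<^sub>R g) \<bullet> (d *\<^sub>R g) = 0"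
    by (metis inner_zero_right)
  then show ?thesis
    using f(2) by simp
qed

lemma sigmoid_inject: "sigmoid s = sigmoid t \<longleftrightarrow> s = t"
proof -
  have "1 + exp (- u) \<noteq> (0::real)" for u
    by (smt (verit) exp_gt_zero)
  then show ?thesis
    by (auto simp: sigmoid_def field_simps)
qed

text \<open>Since \<open>1 - sigmoid t = exp (- t) * sigmoid t\<close>, the two logarithms differ by
  \<open>t\<close>. The label thus enters linearly, which lets the sum over the data set
  collapse.\<close>

lemma cross_entropy_sigmoid:
  "- y * ln (sigmoid t) - (1 - y) * ln (1 - sigmoid t) = ln (1 + exp (- t)) + (1 - y) * t"
proof -
  have pos: "0 < 1 + exp (- t)"
    by (simp add: add_pos_pos)
  have "ln (sigmoid t) = - ln (1 + exp (- t))"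
    using pos by (simp add: sigmoid_def ln_div)
  moreover have "1 - sigmoid t = exp (- t) / (1 + exp (- t))"
    using pos by (simp add: sigmoid_def field_simps)
  then have "ln (1 - sigmoid t) = - t - ln (1 + exp (- t))"
    using pos by (simp add: ln_div)
  ultimately show ?thesis
    by (simp only:) (simp add: algebra_simps)
qed

lemma DERIV_ln_1_plus_exp_uminus:
  "DERIV (\<lambda>t. ln (1 + exp (- t))) t :> sigmoid t - 1"
proof -
  have pos: "0 < 1 + exp (- t)"
    by (simp add: add_pos_pos)
  show ?thesis
    using pos by (auto intro!: derivative_eq_intros simp: sigmoid_def field_simps)
qed

text \<open>The data set enters \<open>loss_v\<close> only through this sum and
  \<open>match_labels\<close>; their quotient is the mean label of the matching points.\<close>

definition match_count :: "((real ^ 'n) \<times> real) multiset \<Rightarrow> real ^ 'n \<Rightarrow> 'n set \<Rightarrow> real" where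
  "match_count D x S = (\<Sum>(x', y') \<in># D. of_bool (subfeatures x' S = subfeatures x S))"

definition match_labels :: "((real ^ 'n) \<times> real) multiset \<Rightarrow> real ^ 'n \<Rightarrow> 'n set \<Rightarrow> real" where
  "match_labels D x S = (\<Sum>(x', y') \<in># D. of_bool (subfeatures x' S = subfeatures x S) * y')"

text \<open>A training point matches itself on every \<open>S\<close> and contributes 1. This keeps
  the quotients by \<open>match_count\<close> away from division by zero.\<close>

lemma match_count_pos:
  assumes "x \<in># image_mset fst D"
  shows "match_count D x S > 0"
proof -
  obtain y where "(x, y) \<in># D"
    using assms by auto
  then obtain D' where D: "D = add_mset (x, y) D'"
    by (metis mset_add)
  have "match_count D' x S \<ge> 0"
    unfolding match_count_def by (induction D') auto
  then show ?thesis
    by (simp add: D match_count_def)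
qed

text \<open>Exhibits the loss as a scalar function of the single number \<open>F \<theta>\<close>,
  the shape that \<open>GDERIV_compose_zeroD\<close> takes.\<close>

lemma loss_v_eq:
  fixes \<Delta> :: "('n::finite, 'q::finite) marginal_module" and \<phi>\<^sub>0 x S os
  defines "F \<equiv> variant_output \<phi>\<^sub>0 \<Delta> x S os"
  shows "loss_v D \<phi>\<^sub>0 \<Delta> x S os \<theta> =
    (match_count D x S * ln (1 + exp (- F \<theta>)) +
      (match_count D x S - match_labels D x S) * F \<theta>) / match_count D x S"
proof -
  have "(\<Sum>(x', y') \<in># D. of_bool (subfeatures x' S = subfeatures x S) * loss_m \<phi>\<^sub>0 \<Delta> x S y' os \<theta>)
    = match_count D x S * ln (1 + exp (- F \<theta>)) +
      (match_count D x S - match_labels D x S) * F \<theta>"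
    unfolding loss_m_def cross_entropy_sigmoid F_def match_count_def match_labels_def
    by (induction D) (auto simp: algebra_simps)
  then show ?thesis
    by (simp add: loss_v_def match_count_def)
qed

text \<open>The point is that the right-hand side does not mention \<open>os\<close>. With count
  \<open>W\<close> and label sum \<open>Y\<close>, stationarity reads
  \<open>W * sigmoid (F \<theta>) = Y\<close>.\<close>

lemma sigmoid_variant_output:
  fixes \<Delta> :: "('n::finite, 'q::finite) marginal_module"
  assumes "x \<in># image_mset fst D"
    and loss: "GDERIV (loss_v D \<phi>\<^sub>0 \<Delta> x S os) \<theta> :> 0"
    and out: "GDERIV (variant_output \<phi>\<^sub>0 \<Delta> x S os) \<theta> :> g" "g \<noteq> 0"
  shows "sigmoid (variant_output \<phi>\<^sub>0 \<Delta> x S os \<theta>) = match_labels D x S / match_count D x S"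
proof -
  let ?W = "match_count D x S" and ?Y = "match_labels D x S"
  let ?F = "variant_output \<phi>\<^sub>0 \<Delta> x S os"
  have W: "?W > 0"
    using assms(1) by (rule match_count_pos)
  have "DERIV (\<lambda>t. (?W * ln (1 + exp (- t)) + (?W - ?Y) * t) / ?W) (?F \<theta>) :>
      (?W * (sigmoid (?F \<theta>) - 1) + (?W - ?Y)) / ?W"
    by (intro DERIV_cdivide DERIV_add DERIV_cmult DERIV_cmult_Id DERIV_ln_1_plus_exp_uminus)
  moreover have "GDERIV (\<lambda>\<theta>. (?W * ln (1 + exp (- ?F \<theta>)) + (?W - ?Y) * ?F \<theta>) / ?W) \<theta> :> 0"
    using loss by (simp add: loss_v_eq[abs_def])
  ultimately have "(?W * (sigmoid (?F \<theta>) - 1) + (?W - ?Y)) / ?W = 0"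
    by (rule GDERIV_compose_zeroD[OF out])
  then show ?thesis
    using W by (simp add: field_simps)
qed

text \<open>With the module parameters fixed, the loss is a mean of squares
  \<open>(u - c os)\<^sup>2\<close> in one real variable \<open>u\<close>, stationary only at the
  mean of the \<open>c os\<close>.\<close>

lemma attribution_eq_mean_marginal:
  fixes \<phi> :: "('n::finite, 'p::finite) attribution_network"
  assumes loss: "GDERIV (loss_s \<Delta> \<theta>\<^sub>\<Delta> \<phi> x S i) \<theta> :> 0"
    and out: "GDERIV (\<lambda>\<theta>. \<phi> (subfeatures x S) \<theta> i) \<theta> :> g" "g \<noteq> 0"
  shows "\<phi> (subfeatures x S) \<theta> i = 1 / fact (card S) *
    (\<Sum>os \<in> permutations_of_set S. \<Sum>k = 1..card S.
      of_bool (os ! (k - 1) = i) * marginal \<Delta> x i (take (k - 1) os) \<theta>\<^sub>\<Delta>)"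
proof -
  define c where "c os = (\<Sum>k = 1..card S.
      of_bool (os ! (k - 1) = i) * marginal \<Delta> x i (take (k - 1) os) \<theta>\<^sub>\<Delta>)" for os
  let ?P = "permutations_of_set S" and ?u = "\<phi> (subfeatures x S) \<theta> i"
  have "DERIV (\<lambda>u. 1 / fact (card S) * (\<Sum>os\<in>?P. (u - c os)\<^sup>2)) ?u :>
      1 / fact (card S) * (\<Sum>os\<in>?P. 2 * (?u - c os))"
    by (auto intro!: derivative_eq_intros sum.cong)
  moreover have "GDERIV (\<lambda>\<theta>. 1 / fact (card S) *
      (\<Sum>os\<in>?P. (\<phi> (subfeatures x S) \<theta> i - c os)\<^sup>2)) \<theta> :> 0"
    using loss unfolding loss_s_def[abs_def] c_def .
  ultimately have "1 / fact (card S) * (\<Sum>os\<in>?P. 2 * (?u - c os)) = 0"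
    by (rule GDERIV_compose_zeroD[OF out])
  then have "(\<Sum>os\<in>?P. ?u - c os) = 0"
    by (simp del: right_diff_distrib_numeral flip: sum_distrib_left)
  \<comment> \<open>There are \<open>fact (card S)\<close> orderings, so the constant
    \<open>u\<close> sums to this multiple.\<close>
  then have "fact (card S) * ?u = (\<Sum>os\<in>?P. c os)"
    by (simp add: sum_subtractf)
  then show ?thesis
    unfolding c_def[symmetric] by (simp add: field_simps)
qed

lemma final_output_eq_mean_variant_output:
  fixes \<phi> :: "('n::finite, 'p::finite) attribution_network"
  assumes "\<And>i. i \<in> S \<Longrightarrow> \<phi> (subfeatures x S) \<theta> i = 1 / fact (card S) *
    (\<Sum>os \<in> permutations_of_set S. \<Sum>k = 1..card S.
      of_bool (os ! (k - 1) = i) * marginal \<Delta> x i (take (k - 1) os) \<theta>\<^sub>\<Delta>)"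
  shows "final_output \<phi>\<^sub>0 \<phi> x S \<theta> = 1 / fact (card S) *
    (\<Sum>os \<in> permutations_of_set S. variant_output \<phi>\<^sub>0 \<Delta> x S os \<theta>\<^sub>\<Delta>)"
proof -
  let ?P = "permutations_of_set S"
  let ?m = "\<lambda>os k i. of_bool (os ! (k - 1) = i) * marginal \<Delta> x i (take (k - 1) os) \<theta>\<^sub>\<Delta>"
  \<comment> \<open>The entry at position \<open>k\<close> lies in \<open>S\<close>, so exactly one
    indicator survives.\<close>
  have pick: "(\<Sum>i\<in>S. ?m os k i) = marginal \<Delta> x (os ! (k - 1)) (take (k - 1) os) \<theta>\<^sub>\<Delta>"
    if "os \<in> ?P" "k \<in> {1..card S}" for os k
  proof -
    have "set os = S" "length os = card S"
      using that(1) by (auto simp: permutations_of_set_def distinct_card)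
    then have "os ! (k - 1) \<in> S"
      using that(2) by (metis Suc_pred' atLeastAtMost_iff less_eq_Suc_le nth_mem
          One_nat_def)
    then have "(\<Sum>i\<in>S. if os ! (k - 1) = i then marginal \<Delta> x i (take (k - 1) os) \<theta>\<^sub>\<Delta> else 0) =
        marginal \<Delta> x (os ! (k - 1)) (take (k - 1) os) \<theta>\<^sub>\<Delta>"
      by simp
    then show ?thesis
      by (simp add: of_bool_def if_distrib[of "\<lambda>z. z * _"] cong: if_cong)
  qed
  have "(\<Sum>i\<in>S. \<phi> (subfeatures x S) \<theta> i) =
      1 / fact (card S) * (\<Sum>i\<in>S. \<Sum>os\<in>?P. \<Sum>k = 1..card S. ?m os k i)"
    by (simp add: assms flip: sum_divide_distrib)
  also have "(\<Sum>i\<in>S. \<Sum>os\<in>?P. \<Sum>k = 1..card S. ?m os k i) =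
      (\<Sum>os\<in>?P. \<Sum>k = 1..card S. \<Sum>i\<in>S. ?m os k i)"
    by (subst sum.swap, intro sum.cong refl, rule sum.swap)
  also have "\<dots> = (\<Sum>os\<in>?P. \<Sum>k = 1..card S.
      marginal \<Delta> x (os ! (k - 1)) (take (k - 1) os) \<theta>\<^sub>\<Delta>)"
    by (intro sum.cong refl pick)
  finally show ?thesis
    \<comment> \<open>The offset \<open>\<phi>\<^sub>0\<close> survives averaging because the
      weights of the orderings add up to 1.\<close>
    by (simp add: final_output_def variant_output_def sum.distrib field_simps)
qed

text \<open>The outputs on prefixes are partial sums of one series. Distinctness makes the
  cardinality that bounds each sum equal to the prefix length.\<close>

lemma variant_output_take_diff:
  assumes "distinct os" "k < length os"
  shows "variant_output \<phi>\<^sub>0 \<Delta> x (set (take (Suc k) os)) (take (Suc k) os) \<theta> -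
      variant_output \<phi>\<^sub>0 \<Delta> x (set (take k os)) (take k os) \<theta> =
    marginal \<Delta> x (os ! k) (take k os) \<theta>"
proof -
  have out: "variant_output \<phi>\<^sub>0 \<Delta> x (set (take l os)) (take l os) \<theta> =
      \<phi>\<^sub>0 + (\<Sum>j<l. marginal \<Delta> x (os ! j) (take j os) \<theta>)" if "l \<le> length os" for l
  proof -
    have "card (set (take l os)) = l"
      using assms(1) that by (simp add: distinct_card)
    moreover have "(\<Sum>j = 1..l. marginal \<Delta> x (take l os ! (j - 1)) (take (j - 1) (take l os)) \<theta>) =
        (\<Sum>j<l. marginal \<Delta> x (os ! j) (take j os) \<theta>)"
      \<comment> \<open>Shifts positions counted from 1 to list indices counted from 0.\<close>
      by (rule sum.reindex_bij_witness[of _ Suc "\<lambda>j. j - 1"]) (auto simp: min_def)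
    ultimately show ?thesis
      by (simp add: variant_output_def)
  qed
  show ?thesis
    using assms(2) by (simp add: out)
qed

theorem theorem3p5:
  fixes D :: "((real ^ 'n) \<times> real) multiset"
    and x :: "real ^ 'n"
    and \<phi>\<^sub>0 :: real
    and \<Delta> :: "('n, 'q::finite) marginal_module"
    and \<phi> :: "('n, 'p::finite) attribution_network"
    and \<theta>\<^sub>\<Delta> :: "real ^ 'q"
    and \<theta>\<^sub>\<phi> :: "real ^ 'p"
  assumes labels: "\<forall>(x', y') \<in># D. y' \<in> {0, 1}"
    and training: "x \<in># image_mset fst D"
    and diff_\<Delta>: "\<And>j js \<theta>. distinct (js @ [j]) \<Longrightarrow> marginal \<Delta> x j js differentiable (at \<theta>)"
    and diff_\<phi>: "\<And>S i \<theta>. i \<in> S \<Longrightarrow> (\<lambda>\<theta>'. \<phi> (subfeatures x S) \<theta>' i) differentiable (at \<theta>)"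
    and optimal_v: "\<And>S os. S \<noteq> {} \<Longrightarrow> os \<in> permutations_of_set S \<Longrightarrow>
          GDERIV (loss_v D \<phi>\<^sub>0 \<Delta> x S os) \<theta>\<^sub>\<Delta> :> 0 \<and>
          (\<exists>g. GDERIV (variant_output \<phi>\<^sub>0 \<Delta> x S os) \<theta>\<^sub>\<Delta> :> g \<and> g \<noteq> 0)"
    and optimal_s: "\<And>S i. S \<noteq> {} \<Longrightarrow> i \<in> S \<Longrightarrow>
          GDERIV (loss_s \<Delta> \<theta>\<^sub>\<Delta> \<phi> x S i) \<theta>\<^sub>\<phi> :> 0 \<and>
          (\<exists>g. GDERIV (\<lambda>\<theta>. \<phi> (subfeatures x S) \<theta> i) \<theta>\<^sub>\<phi> :> g \<and> g \<noteq> 0)"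
  shows "\<forall>i. \<phi> (subfeatures x UNIV) \<theta>\<^sub>\<phi> i =
           shapley_value (\<lambda>S. final_output \<phi>\<^sub>0 \<phi> x S \<theta>\<^sub>\<phi>) i"
proof
  fix i
  have variant_unique: "variant_output \<phi>\<^sub>0 \<Delta> x S os \<theta>\<^sub>\<Delta> = variant_output \<phi>\<^sub>0 \<Delta> x S os' \<theta>\<^sub>\<Delta>"
    if "os \<in> permutations_of_set S" "os' \<in> permutations_of_set S" for S os os'
  \<comment> \<open>Optimality is assumed for nonempty \<open>S\<close> only; the empty set has a
    single ordering.\<close>
  proof (cases "S = {}")
    case True
    then show ?thesis
      using that by simp
  next
    case False
    have "sigmoid (variant_output \<phi>\<^sub>0 \<Delta> x S os \<theta>\<^sub>\<Delta>) = match_labels D x S / match_count D x S"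
      if "os \<in> permutations_of_set S" for os
      using optimal_v[OF False that] sigmoid_variant_output[OF training] by blast
    then have "sigmoid (variant_output \<phi>\<^sub>0 \<Delta> x S os \<theta>\<^sub>\<Delta>) = sigmoid (variant_output \<phi>\<^sub>0 \<Delta> x S os' \<theta>\<^sub>\<Delta>)"
      using that by simp
    then show ?thesis
      by (simp only: sigmoid_inject)
  qed
  have attribution: "\<phi> (subfeatures x S) \<theta>\<^sub>\<phi> j = 1 / fact (card S) *
      (\<Sum>os \<in> permutations_of_set S. \<Sum>k = 1..card S.
        of_bool (os ! (k - 1) = j) * marginal \<Delta> x j (take (k - 1) os) \<theta>\<^sub>\<Delta>)"
    if "j \<in> S" for S j
  proof -
    have "S \<noteq> {}"
      using that by blast
    then show ?thesis
      using optimal_s[OF _ that] attribution_eq_mean_marginal by blast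
  qed
  \<comment> \<open>By \<open>variant_unique\<close> the mean over orderings is a mean of equal
    numbers. The case \<open>os = []\<close> matters too: it is the empty prefix in the Shapley sum
    at \<open>k = 1\<close>.\<close>
  have final_eq: "final_output \<phi>\<^sub>0 \<phi> x (set os) \<theta>\<^sub>\<phi> = variant_output \<phi>\<^sub>0 \<Delta> x (set os) os \<theta>\<^sub>\<Delta>"
    if "distinct os" for os
  proof -
    have os: "os \<in> permutations_of_set (set os)"
      using that by (simp add: permutations_of_set_def)
    have "final_output \<phi>\<^sub>0 \<phi> x (set os) \<theta>\<^sub>\<phi> = 1 / fact (card (set os)) *
        (\<Sum>os' \<in> permutations_of_set (set os). variant_output \<phi>\<^sub>0 \<Delta> x (set os) os' \<theta>\<^sub>\<Delta>)"
      by (rule final_output_eq_mean_variant_output) (rule attribution)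
    also have "(\<Sum>os' \<in> permutations_of_set (set os). variant_output \<phi>\<^sub>0 \<Delta> x (set os) os' \<theta>\<^sub>\<Delta>) =
        (\<Sum>os' \<in> permutations_of_set (set os). variant_output \<phi>\<^sub>0 \<Delta> x (set os) os \<theta>\<^sub>\<Delta>)"
      using os by (intro sum.cong refl variant_unique)
    finally show ?thesis
      by simp
  qed
  \<comment> \<open>The indicator stays on both sides because the marginal is taken at
    \<open>i\<close>, which is the entry at position \<open>k\<close> only when the indicator is
    1.\<close>
  have marginal_eq: "of_bool (os ! (k - 1) = i) * marginal \<Delta> x i (take (k - 1) os) \<theta>\<^sub>\<Delta> =
      of_bool (os ! (k - 1) = i) * (final_output \<phi>\<^sub>0 \<phi> x (set (take k os)) \<theta>\<^sub>\<phi> -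
        final_output \<phi>\<^sub>0 \<phi> x (set (take (k - 1) os)) \<theta>\<^sub>\<phi>)"
    if os: "os \<in> permutations_of_set UNIV" and k: "k \<in> {1..CARD('n)}" for os k
  proof -
    have "distinct os" "length os = CARD('n)"
      using os distinct_card[of os] by (auto simp: permutations_of_set_def)
    then show ?thesis
      using k variant_output_take_diff[of os "k - 1" \<phi>\<^sub>0 \<Delta> x \<theta>\<^sub>\<Delta>] by (auto simp: final_eq)
  qed
  show "\<phi> (subfeatures x UNIV) \<theta>\<^sub>\<phi> i =
      shapley_value (\<lambda>S. final_output \<phi>\<^sub>0 \<phi> x S \<theta>\<^sub>\<phi>) i"
    unfolding shapley_value_def attribution[OF UNIV_I]
    by (intro arg_cong[where f = "(*) _"] sum.cong refl marginal_eq)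
qed

end
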